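(* Let $N$ be a positive integer, let $\epsilon_N=e^{2\pi i/N}$, let $W$ be a $\mathbb C^{p\times q}$-valued Schur function and let $\varphi(z)=\epsilon_N z$. Then the operator of composition by $\varphi$, $f\mapsto f\circ\varphi$, is a contraction from $\mathcal H(W)$ into itself if and only if there exists a $\mathbb C^{q\times q}$-valued Schur function $X(z)$ such that $$W(z)=W(\epsilon_N z)X(z),\quad z\in\mathbb D.$$
   Context: $\mathbb D$ is the open unit disk; $w^*$ denotes the complex conjugate of $w\in\mathbb C$. A matrix-valued Schur function is a function analytic in $\mathbb D$ taking contractive matrix values there (here possibly non-square). For a $\mathbb C^{p\times q}$-valued Schur function $W$, the kernel $K_W(z,w)=\frac{I_p-W(z)W(w)^*}{1-zw^*}$ is positive definite in $\mathbb D$, and $\mathcal H(W)$ denotes the reproducing kernel Hilbert space of $\mathbb C^p$-valued functions with reproducing kernel $K_W$. *)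

theory Defs
  imports "HOL-Complex_Analysis.Complex_Analysis"
begin

abbreviation unit_disk :: "complex set" where
  "unit_disk \<equiv> ball 0 1"

definition cinner :: "complex ^ 'n \<Rightarrow> complex ^ 'n \<Rightarrow> complex" where
  "cinner u v = (\<Sum>i\<in>UNIV. u $ i * cnj (v $ i))"

definition conj_transpose :: "complex ^ 'n ^ 'm \<Rightarrow> complex ^ 'm ^ 'n" where
  "conj_transpose A = (\<chi> i j. cnj (A $ j $ i))"

text \<open>
  A \<open>p \<times> q\<close> matrix has type \<open>complex ^ 'q ^ 'p\<close>; contractivity is with respect to the
  Euclidean norms of \<open>complex ^ 'q\<close> and \<open>complex ^ 'p\<close>. The values of a Schur function
  outside the open unit disk are irrelevant.
\<close>

definition schur_function :: "(complex \<Rightarrow> complex ^ 'q ^ 'p) \<Rightarrow> bool" where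
  "schur_function W \<longleftrightarrow>
     (\<forall>i j. (\<lambda>z. W z $ i $ j) holomorphic_on unit_disk) \<and>
     (\<forall>z\<in>unit_disk. \<forall>v. norm (W z *v v) \<le> norm v)"

definition schur_kernel ::
    "(complex \<Rightarrow> complex ^ 'q ^ 'p) \<Rightarrow> complex \<Rightarrow> complex \<Rightarrow> complex ^ 'p ^ 'p" where
  "schur_kernel W z w =
     (\<chi> i j. (mat 1 - W z ** conj_transpose (W w)) $ i $ j / (1 - z * cnj w))"

text \<open>
  A Hilbert space of functions \<open>D \<rightarrow> \<complex>\<^sup>n\<close>, given by its carrier \<open>H\<close> and its inner product
  \<open>ip\<close> (linear in the first argument). A function on \<open>D\<close> is represented by its extension
  by \<open>0\<close> to the whole type, so that equality on \<open>D\<close> is equality in HOL and the carrier is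
  closed under the pointwise operations. The values of \<open>ip\<close> off the carrier are irrelevant.
\<close>

definition ip_norm :: "('a \<Rightarrow> 'a \<Rightarrow> complex) \<Rightarrow> 'a \<Rightarrow> real" where
  "ip_norm ip f = sqrt (Re (ip f f))"

locale hilbert_function_space =
  fixes D :: "'a set"
    and H :: "('a \<Rightarrow> complex ^ 'n) set"
    and ip :: "('a \<Rightarrow> complex ^ 'n) \<Rightarrow> ('a \<Rightarrow> complex ^ 'n) \<Rightarrow> complex"
  assumes zero_outside: "f \<in> H \<Longrightarrow> x \<notin> D \<Longrightarrow> f x = 0"
    and zero_mem: "(\<lambda>x. 0) \<in> H"
    and add_mem: "f \<in> H \<Longrightarrow> g \<in> H \<Longrightarrow> (\<lambda>x. f x + g x) \<in> H"
    and scale_mem: "f \<in> H \<Longrightarrow> (\<lambda>x. c *s f x) \<in> H"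
    and ip_add: "f \<in> H \<Longrightarrow> g \<in> H \<Longrightarrow> h \<in> H \<Longrightarrow> ip (\<lambda>x. f x + g x) h = ip f h + ip g h"
    and ip_scale: "f \<in> H \<Longrightarrow> g \<in> H \<Longrightarrow> ip (\<lambda>x. c *s f x) g = c * ip f g"
    and ip_commute: "f \<in> H \<Longrightarrow> g \<in> H \<Longrightarrow> ip g f = cnj (ip f g)"
    and ip_nonneg: "f \<in> H \<Longrightarrow> 0 \<le> Re (ip f f)"
    and ip_definite: "f \<in> H \<Longrightarrow> ip f f = 0 \<Longrightarrow> f = (\<lambda>x. 0)"
    and complete:
      "(\<And>n::nat. F n \<in> H) \<Longrightarrow>
       (\<And>e. e > 0 \<Longrightarrow> \<exists>M. \<forall>m\<ge>M. \<forall>n\<ge>M. ip_norm ip (\<lambda>x. F m x - F n x) < e) \<Longrightarrow>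
       \<exists>f\<in>H. (\<lambda>n. ip_norm ip (\<lambda>x. F n x - f x)) \<longlonglongrightarrow> 0"

text \<open>
  \<open>kernel_section D K w c\<close> is the function \<open>K(\<cdot>, w) c\<close> on \<open>D\<close>. The reproducing property
  reads \<open>\<langle>f, K(\<cdot>, w) c\<rangle> = c\<^sup>* f(w)\<close>. By the Moore-Aronszajn theorem, a positive definite
  kernel on \<open>D\<close> determines \<open>H\<close>, and \<open>ip\<close> on \<open>H\<close>, uniquely.
\<close>

definition kernel_section ::
    "'a set \<Rightarrow> ('a \<Rightarrow> 'a \<Rightarrow> complex ^ 'n ^ 'n) \<Rightarrow> 'a \<Rightarrow> complex ^ 'n \<Rightarrow> 'a \<Rightarrow> complex ^ 'n" where
  "kernel_section D K w c = (\<lambda>z. if z \<in> D then K z w *v c else 0)"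

locale reproducing_kernel_hilbert_space = hilbert_function_space D H ip
  for D :: "'a set"
    and K :: "'a \<Rightarrow> 'a \<Rightarrow> complex ^ 'n ^ 'n"
    and H :: "('a \<Rightarrow> complex ^ 'n) set"
    and ip :: "('a \<Rightarrow> complex ^ 'n) \<Rightarrow> ('a \<Rightarrow> complex ^ 'n) \<Rightarrow> complex" +
  assumes kernel_mem: "w \<in> D \<Longrightarrow> kernel_section D K w c \<in> H"
    and reproducing: "w \<in> D \<Longrightarrow> f \<in> H \<Longrightarrow> ip f (kernel_section D K w c) = cinner (f w) c"

text \<open>The pair \<open>(H, ip)\<close> is the space \<open>\<H>(W)\<close>.\<close>

abbreviation is_schur_space ::
    "(complex \<Rightarrow> complex ^ 'q ^ 'p) \<Rightarrow> (complex \<Rightarrow> complex ^ 'p) set \<Rightarrow>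
     ((complex \<Rightarrow> complex ^ 'p) \<Rightarrow> (complex \<Rightarrow> complex ^ 'p) \<Rightarrow> complex) \<Rightarrow> bool" where
  "is_schur_space W H ip \<equiv> reproducing_kernel_hilbert_space unit_disk (schur_kernel W) H ip"

definition contraction_into_itself ::
    "'b set \<Rightarrow> ('b \<Rightarrow> 'b \<Rightarrow> complex) \<Rightarrow> ('b \<Rightarrow> 'b) \<Rightarrow> bool" where
  "contraction_into_itself H ip T \<longleftrightarrow>
     (\<forall>f\<in>H. T f \<in> H \<and> ip_norm ip (T f) \<le> ip_norm ip f)"

definition root_of_unity :: "nat \<Rightarrow> complex" where
  "root_of_unity N = exp (2 * of_real pi * \<i> / of_nat N)"

text \<open>
  This map permutes both the unit disk and its complement, so composition with it respects
  the convention that functions on the disk vanish outside.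
\<close>

definition rotation :: "nat \<Rightarrow> complex \<Rightarrow> complex" where
  "rotation N z = root_of_unity N * z"

end

theory Submission
  imports Defs
begin

text \<open>
  Let \<open>C f = f \<circ> \<phi>\<close>. Since \<open>C\<close> has finite order, it is a contraction only if it is unitary, and then
  the kernel is invariant: \<open>K(\<phi> z, \<phi> w) = K(z, w)\<close>, that is, \<open>W(\<epsilon>z) W(\<epsilon>w)\<^sup>* = W(z) W(w)\<^sup>*\<close>. The map
  \<open>W(\<epsilon>w)\<^sup>* c \<mapsto> W(w)\<^sup>* c\<close> is then isometric on its span in \<open>\<complex>\<^sup>q\<close>, and a contractive extension
  provides a factor \<open>X\<close> that is even constant, so that Leech's theorem is avoided. Conversely,
  \<open>W(z) = W(\<epsilon>z) X(z)\<close> yields \<open>\<parallel>W(z)\<^sup>* c\<parallel> \<le> \<parallel>W(\<epsilon>z)\<^sup>* c\<parallel> \<le> \<dots> \<le> \<parallel>W(\<epsilon>\<^sup>N z)\<^sup>* c\<parallel> = \<parallel>W(z)\<^sup>* c\<parallel>\<close>; the resulting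
  identity \<open>W(z) W(z)\<^sup>* = W(\<epsilon>z) W(\<epsilon>z)\<^sup>*\<close> extends off the diagonal by analyticity, so the
  kernel is invariant and \<open>C\<close> is isometric.
\<close>

subsection \<open>Projections in Hilbert function spaces\<close>

context hilbert_function_space
begin

section \<open>Inner product algebra and the Cauchy-Schwarz inequality\<close>

lemma diff_mem:
  assumes "f \<in> H" "g \<in> H"
  shows "(\<lambda>x. f x - g x) \<in> H"
  using add_mem[OF assms(1) scale_mem[OF assms(2), of "-1"]] by simp

lemma ip_diff_left:
  assumes "f \<in> H" "g \<in> H" "h \<in> H"
  shows "ip (\<lambda>x. f x - g x) h = ip f h - ip g h"
  using ip_add[OF assms(1) scale_mem[OF assms(2), of "-1"] assms(3)]
    ip_scale[OF assms(2,3), of "-1"] by simp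

lemma ip_add_right:
  assumes "f \<in> H" "g \<in> H" "h \<in> H"
  shows "ip h (\<lambda>x. f x + g x) = ip h f + ip h g"
  using ip_commute[OF add_mem[OF assms(1,2)] assms(3)] ip_commute[OF assms(1,3)]
    ip_commute[OF assms(2,3)] ip_add[OF assms] by simp

lemma ip_scale_right:
  assumes "f \<in> H" "g \<in> H"
  shows "ip g (\<lambda>x. c *s f x) = cnj c * ip g f"
  using ip_commute[OF scale_mem[OF assms(1)] assms(2)] ip_commute[OF assms] ip_scale[OF assms] by simp

lemma ip_diff_right:
  assumes "f \<in> H" "g \<in> H" "h \<in> H"
  shows "ip h (\<lambda>x. f x - g x) = ip h f - ip h g"
  using ip_commute[OF diff_mem[OF assms(1,2)] assms(3)] ip_commute[OF assms(1,3)]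
    ip_commute[OF assms(2,3)] ip_diff_left[OF assms] by simp

lemma ip_norm_nonneg: "f \<in> H \<Longrightarrow> 0 \<le> ip_norm ip f"
  by (simp add: ip_norm_def ip_nonneg)

lemma ip_norm_square: "f \<in> H \<Longrightarrow> (ip_norm ip f)\<^sup>2 = Re (ip f f)"
  by (simp add: ip_norm_def ip_nonneg)

lemma ip_self: "f \<in> H \<Longrightarrow> ip f f = of_real ((ip_norm ip f)\<^sup>2)"
  using ip_commute[of f f] by (simp add: ip_norm_square complex_eq_iff)

lemma ip_norm_eq_0: "f \<in> H \<Longrightarrow> ip_norm ip f = 0 \<Longrightarrow> f = (\<lambda>x. 0)"
  using ip_self ip_definite by fastforce

lemma ip_norm_add_square:
  assumes "f \<in> H" "g \<in> H"
  shows "(ip_norm ip (\<lambda>x. f x + g x))\<^sup>2 =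
    (ip_norm ip f)\<^sup>2 + (ip_norm ip g)\<^sup>2 + 2 * Re (ip f g)"
  using ip_commute[OF assms] assms
  by (simp add: ip_norm_square add_mem ip_add ip_add_right)

lemma ip_norm_diff_square:
  assumes "f \<in> H" "g \<in> H"
  shows "(ip_norm ip (\<lambda>x. f x - g x))\<^sup>2 =
    (ip_norm ip f)\<^sup>2 + (ip_norm ip g)\<^sup>2 - 2 * Re (ip f g)"
  using ip_commute[OF assms] assms
  by (simp add: ip_norm_square diff_mem ip_diff_left ip_diff_right)

lemma ip_norm_scale:
  assumes "f \<in> H"
  shows "ip_norm ip (\<lambda>x. c *s f x) = cmod c * ip_norm ip f"
proof -
  have "ip (\<lambda>x. c *s f x) (\<lambda>x. c *s f x) = of_real ((cmod c * ip_norm ip f)\<^sup>2)"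
    using complex_norm_square[of c] ip_self[OF assms] assms
    by (simp add: ip_scale ip_scale_right scale_mem power_mult_distrib)
  then show ?thesis
    by (simp add: ip_norm_def[of ip "\<lambda>x. c *s f x"] ip_norm_nonneg assms)
qed

lemma ip_norm_minus_commute:
  assumes "f \<in> H" "g \<in> H"
  shows "ip_norm ip (\<lambda>x. f x - g x) = ip_norm ip (\<lambda>x. g x - f x)"
  using ip_norm_scale[OF diff_mem[OF assms], of "-1"] by simp

lemma Re_ip_le:
  assumes "f \<in> H" "g \<in> H"
  shows "Re (ip f g) \<le> ip_norm ip f * ip_norm ip g"
proof (cases "ip_norm ip g = 0")
  case True
  then have "g = (\<lambda>x. 0)" by (rule ip_norm_eq_0[OF assms(2)])
  then have "ip f g = 0" using ip_diff_right[OF assms(2,2,1)] by simp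
  then show ?thesis using True by simp
next
  case False
  define a b where "a = ip_norm ip f" and "b = ip_norm ip g"
  have b: "b > 0" using False ip_norm_nonneg[OF assms(2)] b_def by linarith
  have a: "a \<ge> 0" using ip_norm_nonneg[OF assms(1)] a_def by simp
  \<comment> \<open>Weighting \<open>f\<close> by the norm of \<open>g\<close> and vice versa makes
    both square terms equal to (a b)^2, so nonnegativity leaves Cauchy-Schwarz multiplied by a b;
    hence the separate treatment of vanishing norms.\<close>
  have "0 \<le> (ip_norm ip (\<lambda>x. of_real b *s f x - of_real a *s g x))\<^sup>2" by simp
  also have "\<dots> = (b * a)\<^sup>2 + (a * b)\<^sup>2 - 2 * (a * b * Re (ip f g))"
    using assms a b ip_norm_diff_square[OF scale_mem[OF assms(1), of "of_real b"] scale_mem[OF assms(2), of "of_real a"]]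
    by (simp add: ip_norm_scale ip_scale ip_scale_right scale_mem a_def[symmetric] b_def[symmetric])
  finally have *: "a * b * Re (ip f g) \<le> a * b * (a * b)"
    by (simp add: power2_eq_square algebra_simps)
  show ?thesis
  proof (cases "a = 0")
    case True
    then have "f = (\<lambda>x. 0)" using ip_norm_eq_0[OF assms(1)] by (simp add: a_def)
    then have "ip f g = 0" using ip_diff_left[OF assms(1,1,2)] by simp
    then show ?thesis using True a_def by simp
  next
    case False
    with * a b show ?thesis by (simp add: a_def b_def)
  qed
qed

text \<open>Multiplying \<open>f\<close> by the conjugate phase of \<open>ip f g\<close> makes the
  inner product real and reduces the bound to \<open>Re_ip_le\<close>. If \<open>ip f g = 0\<close>
  the phase \<open>u\<close> is 0, which is why only \<open>cmod u \<le> 1\<close> is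
  recorded.\<close>

lemma cmod_ip_le:
  assumes "f \<in> H" "g \<in> H"
  shows "cmod (ip f g) \<le> ip_norm ip f * ip_norm ip g"
proof -
  define u where "u = cnj (sgn (ip f g))"
  have u: "u * ip f g = of_real (cmod (ip f g))"
    using complex_norm_square[of "ip f g"]
    by (cases "ip f g = 0") (simp_all add: u_def sgn_eq power2_eq_square field_simps)
  have "cmod u \<le> 1" by (simp add: u_def norm_sgn)
  have "cmod (ip f g) = Re (ip (\<lambda>x. u *s f x) g)"
    using u assms by (simp add: ip_scale)
  also have "\<dots> \<le> cmod u * ip_norm ip f * ip_norm ip g"
    using Re_ip_le[OF scale_mem[OF assms(1)] assms(2)] ip_norm_scale[OF assms(1)] by simp
  also have "\<dots> \<le> ip_norm ip f * ip_norm ip g"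
    using \<open>cmod u \<le> 1\<close> by (simp add: mult_left_le_one_le mult.assoc ip_norm_nonneg assms)
  finally show ?thesis .
qed

lemma ip_norm_triangle:
  assumes "f \<in> H" "g \<in> H"
  shows "ip_norm ip (\<lambda>x. f x + g x) \<le> ip_norm ip f + ip_norm ip g"
proof (rule power2_le_imp_le)
  show "(ip_norm ip (\<lambda>x. f x + g x))\<^sup>2 \<le> (ip_norm ip f + ip_norm ip g)\<^sup>2"
    using ip_norm_add_square[OF assms] Re_ip_le[OF assms]
    by (simp add: power2_sum)
qed (simp add: ip_norm_nonneg assms)

lemma ip_norm_diff_triangle:
  assumes "f \<in> H" "g \<in> H" "h \<in> H"
  shows "ip_norm ip (\<lambda>x. f x - h x) \<le> ip_norm ip (\<lambda>x. f x - g x) + ip_norm ip (\<lambda>x. g x - h x)"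
  using ip_norm_triangle[OF diff_mem[OF assms(1,2)] diff_mem[OF assms(2,3)]] by simp

lemma tendsto_ip_left:
  assumes "\<And>n. F n \<in> H" "f \<in> H" "g \<in> H"
    and lim: "(\<lambda>n. ip_norm ip (\<lambda>x. F n x - f x)) \<longlonglongrightarrow> 0"
  shows "(\<lambda>n. ip (F n) g) \<longlonglongrightarrow> ip f g"
proof (rule LIM_zero_cancel, rule Lim_null_comparison)
  show "\<forall>\<^sub>F n in sequentially. norm (ip (F n) g - ip f g)
      \<le> ip_norm ip (\<lambda>x. F n x - f x) * ip_norm ip g"
    using cmod_ip_le[OF diff_mem assms(3)] ip_diff_left assms(1-3) by simp
  show "(\<lambda>n. ip_norm ip (\<lambda>x. F n x - f x) * ip_norm ip g) \<longlonglongrightarrow> 0"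
    using tendsto_mult_right[OF lim] by simp
qed

text \<open>The projection theorem: a closed subspace contains a point \<open>h\<close> nearest to
  \<open>f\<close>, the residual \<open>f - h\<close> is orthogonal to the subspace, and totality
  makes it vanish.\<close>

lemma closed_subspace_total:
  assumes sub: "S \<subseteq> H" and S0: "(\<lambda>x. 0) \<in> S"
    and S_add: "\<And>f g. f \<in> S \<Longrightarrow> g \<in> S \<Longrightarrow> (\<lambda>x. f x + g x) \<in> S"
    and S_scale: "\<And>f c. f \<in> S \<Longrightarrow> (\<lambda>x. c *s f x) \<in> S"
    and S_closed: "\<And>F f. (\<And>n::nat. F n \<in> S) \<Longrightarrow> f \<in> H \<Longrightarrow>
      (\<lambda>n. ip_norm ip (\<lambda>x. F n x - f x)) \<longlonglongrightarrow> 0 \<Longrightarrow> f \<in> S"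
    and total: "\<And>f. f \<in> H \<Longrightarrow> (\<And>s. s \<in> S \<Longrightarrow> ip f s = 0) \<Longrightarrow> f = (\<lambda>x. 0)"
  shows "S = H"
proof (rule antisym[OF sub], rule subsetI)
  fix f assume f: "f \<in> H"
  let ?d = "\<lambda>g. ip_norm ip (\<lambda>x. f x - g x)"
  define d where "d = Inf (?d ` S)"
  have bdd: "bdd_below (?d ` S)"
    using ip_norm_nonneg[OF diff_mem[OF f]] sub by (intro bdd_belowI[where m = 0]) auto
  have d_le: "d \<le> ?d g" if "g \<in> S" for g
    unfolding d_def using bdd that by (intro cINF_lower) auto
  have d0: "0 \<le> d"
    unfolding d_def using S0 ip_norm_nonneg[OF diff_mem[OF f]] sub by (intro cINF_greatest) auto
  \<comment> \<open>The minimizing sequence is controlled through squared distances, the quantities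
    that enter the parallelogram law.\<close>
  have "\<exists>g\<in>S. (?d g)\<^sup>2 < d\<^sup>2 + 1 / real (Suc n)" for n
  proof -
    have "d < sqrt (d\<^sup>2 + 1 / real (Suc n))"
      using d0 by (intro real_less_rsqrt) simp
    then obtain g where g: "g \<in> S" "?d g < sqrt (d\<^sup>2 + 1 / real (Suc n))"
      unfolding d_def using S0 by (subst (asm) cINF_less_iff[OF _ bdd]) auto
    have "(?d g)\<^sup>2 < (sqrt (d\<^sup>2 + 1 / real (Suc n)))\<^sup>2"
      using g sub by (intro power_strict_mono ip_norm_nonneg diff_mem f) auto
    with g show ?thesis by auto
  qed
  then obtain G where G: "\<And>n. G n \<in> S" "\<And>n. (?d (G n))\<^sup>2 < d\<^sup>2 + 1 / real (Suc n)"
    by metis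
  have GH: "G n \<in> H" for n using G sub by blast
  \<comment> \<open>Parallelogram law for \<open>f - G m\<close> and \<open>f - G n\<close>: the
    midpoint of \<open>G m\<close> and \<open>G n\<close> lies in \<open>S\<close>, so the sum has
    norm at least 2 d and the difference must be small.\<close>
  have par: "(ip_norm ip (\<lambda>x. G m x - G n x))\<^sup>2 \<le> 2 / real (Suc m) + 2 / real (Suc n)" for m n
  proof -
    let ?a = "\<lambda>x. f x - G m x" and ?b = "\<lambda>x. f x - G n x"
    have ab: "?a \<in> H" "?b \<in> H" using diff_mem f GH by auto
    have mid: "(\<lambda>x. (1/2) *s (G m x + G n x)) \<in> S" using S_scale S_add G by auto
    have eq: "(\<lambda>x. ?a x + ?b x) = (\<lambda>x. 2 *s (f x - (1/2) *s (G m x + G n x)))"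
      by (auto simp: vec_eq_iff field_simps)
    have "ip_norm ip (\<lambda>x. ?a x + ?b x) = 2 * ?d (\<lambda>x. (1/2) *s (G m x + G n x))"
      unfolding eq using mid sub f by (subst ip_norm_scale) (auto intro: diff_mem)
    then have "2 * d \<le> ip_norm ip (\<lambda>x. ?a x + ?b x)" using d_le[OF mid] by simp
    then have "(2 * d)\<^sup>2 \<le> (ip_norm ip (\<lambda>x. ?a x + ?b x))\<^sup>2" using d0 by (intro power_mono) auto
    moreover have "ip_norm ip (\<lambda>x. G m x - G n x) = ip_norm ip (\<lambda>x. ?b x - ?a x)" by simp
    ultimately show ?thesis
      using ip_norm_add_square[OF ab] ip_norm_diff_square[OF ab(2,1)] ip_commute[OF ab] G(2)[of m] G(2)[of n]
      by (simp add: power2_eq_square)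
  qed
  have "\<exists>h\<in>H. (\<lambda>n. ip_norm ip (\<lambda>x. G n x - h x)) \<longlonglongrightarrow> 0"
  proof (rule complete[OF GH])
    fix e :: real assume e: "e > 0"
    obtain M where M: "4 / e\<^sup>2 < real M" using reals_Archimedean2 by blast
    show "\<exists>M. \<forall>m\<ge>M. \<forall>n\<ge>M. ip_norm ip (\<lambda>x. G m x - G n x) < e"
    proof (intro exI[of _ M] allI impI)
      fix m n assume mn: "M \<le> m" "M \<le> n"
      have "0 < 4 / e\<^sup>2" using e by simp
      then have M0: "0 < real M" using M by linarith
      have "2 / real (Suc m) \<le> 2 / real M" "2 / real (Suc n) \<le> 2 / real M"
        using mn M0 by (auto intro!: divide_left_mono)
      moreover have "4 / real M < e\<^sup>2" using M M0 e by (simp add: field_simps)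
      ultimately have "(ip_norm ip (\<lambda>x. G m x - G n x))\<^sup>2 < e\<^sup>2" using par[of m n] by simp
      then show "ip_norm ip (\<lambda>x. G m x - G n x) < e" using e by (simp add: power_less_imp_less_base)
    qed
  qed
  then obtain h where h: "h \<in> H" and lim: "(\<lambda>n. ip_norm ip (\<lambda>x. G n x - h x)) \<longlonglongrightarrow> 0" by blast
  have hS: "h \<in> S" by (rule S_closed[OF G(1) h lim])
  let ?r = "\<lambda>x. f x - h x"
  have r: "?r \<in> H" using diff_mem f h by blast
  have "(\<lambda>n. sqrt (d\<^sup>2 + 1 / real (Suc n))) \<longlonglongrightarrow> sqrt (d\<^sup>2 + 0)"
    using LIMSEQ_inverse_real_of_nat by (intro tendsto_intros) (simp add: inverse_eq_divide)
  then have "(\<lambda>n. sqrt (d\<^sup>2 + 1 / real (Suc n)) + ip_norm ip (\<lambda>x. G n x - h x)) \<longlonglongrightarrow> d"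
    using tendsto_add[OF _ lim] d0 by fastforce
  moreover have "?d h \<le> sqrt (d\<^sup>2 + 1 / real (Suc n)) + ip_norm ip (\<lambda>x. G n x - h x)" for n
  proof -
    have "?d (G n) \<le> sqrt (d\<^sup>2 + 1 / real (Suc n))" using G(2)[of n] by (intro real_le_rsqrt) simp
    then show ?thesis using ip_norm_diff_triangle[OF f GH[of n] h] by linarith
  qed
  ultimately have "?d h \<le> d" by (intro LIMSEQ_le_const) auto
  have Re0: "Re (ip ?r s) = 0" if s: "s \<in> S" for s
  proof (rule ccontr)
    assume neq: "Re (ip ?r s) \<noteq> 0"
    have sH: "s \<in> H" using s sub by auto
    define q where "q = (ip_norm ip s)\<^sup>2"
    define \<rho> where "\<rho> = Re (ip ?r s)"
    \<comment> \<open>Moving from \<open>h\<close> to \<open>h + t s\<close> cannot decrease the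
      distance to \<open>f\<close>. The optimal step would be rho / q; the denominator q + 1 avoids
      division by zero and still forces t = 0.\<close>
    define t where "t = \<rho> / (q + 1)"
    have q: "q \<ge> 0" by (simp add: q_def)
    have ts: "(\<lambda>x. of_real t *s s x) \<in> H" using scale_mem sH by blast
    have "d \<le> ip_norm ip (\<lambda>x. ?r x - of_real t *s s x)"
      using d_le[OF S_add[OF hS S_scale[OF s, of "of_real t"]]] by (simp add: diff_diff_eq)
    then have "(?d h)\<^sup>2 \<le> (ip_norm ip (\<lambda>x. ?r x - of_real t *s s x))\<^sup>2"
      using \<open>?d h \<le> d\<close> ip_norm_nonneg[OF r] by (intro power_mono) auto
    also have "\<dots> = (?d h)\<^sup>2 + t\<^sup>2 * q - 2 * t * \<rho>"
      unfolding ip_norm_diff_square[OF r ts]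
      using sH r by (simp add: ip_norm_scale ip_scale_right power_mult_distrib q_def \<rho>_def)
    finally have "2 * t * \<rho> \<le> t\<^sup>2 * q" by simp
    moreover have "t * \<rho> = t\<^sup>2 * (q + 1)" using q by (simp add: t_def power2_eq_square)
    ultimately have "t\<^sup>2 * (q + 2) \<le> 0" by (simp add: algebra_simps)
    then have "t = 0" using q by (simp add: mult_le_0_iff)
    then show False using neq q by (simp add: t_def \<rho>_def)
  qed
  \<comment> \<open>The imaginary part is the real part of the pairing with i s.\<close>
  have "ip ?r s = 0" if s: "s \<in> S" for s
    using Re0[OF s] Re0[OF S_scale[OF s, of \<i>]] s sub r
    by (auto simp: ip_scale_right complex_eq_iff)
  then have "?r = (\<lambda>x. 0)" by (rule total[OF r])
  then have "f = h" by (simp add: fun_eq_iff)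
  then show "f \<in> S" using hS by simp
qed

end

subsection \<open>Composition operators and invariance of the kernel\<close>

text \<open>Links the form in the reproducing property to the real Euclidean inner product, whose
  norm defines contractivity of matrices.\<close>

lemma inner_eq_Re_cinner:
  fixes u v :: "complex ^ 'n"
  shows "u \<bullet> v = Re (cinner u v)"
  by (simp add: inner_vec_def cinner_def inner_complex_def)

lemma cinner_right_ext:
  assumes "\<And>d. cinner u d = cinner v d"
  shows "u = v"
  using assms vector_eq_rdot[of u v] by (simp add: inner_eq_Re_cinner)

context reproducing_kernel_hilbert_space
begin

text \<open>Evaluation at \<open>w\<close> is pairing with a kernel section, so norm convergence
  implies pointwise convergence.\<close>

lemma tendsto_cinner_eval:
  assumes "\<And>n. F n \<in> H" "f \<in> H" "w \<in> D"
    and "(\<lambda>n. ip_norm ip (\<lambda>x. F n x - f x)) \<longlonglongrightarrow> 0"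
  shows "(\<lambda>n. cinner (F n w) c) \<longlonglongrightarrow> cinner (f w) c"
  using tendsto_ip_left[OF assms(1,2) kernel_mem[OF assms(3)] assms(4), of c]
  by (simp add: reproducing assms)

text \<open>With \<open>C\<close> the composition, \<open>C^(N-1)\<close> is also a contraction and
  inverts \<open>C\<close>, so the norm of \<open>f\<close> is at most that of \<open>C f\<close>.
  Thus \<open>C\<close> is isometric, preserves inner products by polarization, and invariance
  follows by pairing kernel sections.\<close>

lemma kernel_invariant_if_contraction:
  assumes \<phi>: "\<And>x. \<phi> x \<in> D \<longleftrightarrow> x \<in> D" and "N > 0" and per: "\<And>x. (\<phi> ^^ N) x = x"
    and contr: "contraction_into_itself H ip (\<lambda>f. f \<circ> \<phi>)"
    and zw: "z \<in> D" "w \<in> D"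
  shows "K (\<phi> z) (\<phi> w) = K z w"
proof -
  have C: "f \<circ> \<phi> \<in> H" "ip_norm ip (f \<circ> \<phi>) \<le> ip_norm ip f" if "f \<in> H" for f
    using contr that by (auto simp: contraction_into_itself_def)
  have pow: "f \<circ> \<phi> ^^ n \<in> H \<and> ip_norm ip (f \<circ> \<phi> ^^ n) \<le> ip_norm ip f" if "f \<in> H" for f n
    using that
  proof (induction n arbitrary: f)
    case (Suc n)
    have "f \<circ> \<phi> ^^ Suc n = (f \<circ> \<phi>) \<circ> \<phi> ^^ n" by (simp add: comp_assoc)
    then show ?case using Suc.IH[OF C(1)[OF Suc.prems]] C(2)[OF Suc.prems] by (metis order_trans)
  qed simp
  have undo: "(f \<circ> \<phi>) \<circ> \<phi> ^^ (N - 1) = f" "(f \<circ> \<phi> ^^ (N - 1)) \<circ> \<phi> = f" for f :: "'a \<Rightarrow> complex ^ 'b"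
  proof -
    obtain m where m: "N = Suc m" using \<open>N > 0\<close> gr0_implies_Suc by blast
    have "\<phi> \<circ> \<phi> ^^ m = id" "\<phi> ^^ m \<circ> \<phi> = id" using per m
      by (simp_all add: fun_eq_iff funpow_swap1)
    then show "(f \<circ> \<phi>) \<circ> \<phi> ^^ (N - 1) = f" "(f \<circ> \<phi> ^^ (N - 1)) \<circ> \<phi> = f"
      by (simp_all add: m comp_assoc)
  qed
  have iso: "ip_norm ip (f \<circ> \<phi>) = ip_norm ip f" if "f \<in> H" for f
    using C[OF that] pow[of "f \<circ> \<phi>" "N - 1"] unfolding undo by simp
  have Re_ip: "Re (ip (f \<circ> \<phi>) (g \<circ> \<phi>)) = Re (ip f g)" if fg: "f \<in> H" "g \<in> H" for f g
    using iso[OF add_mem[OF fg]] ip_norm_add_square[OF fg] ip_norm_add_square[OF C(1) C(1), OF fg]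
      iso[OF fg(1)] iso[OF fg(2)] by (simp add: o_def)
  have ip_C: "ip (f \<circ> \<phi>) (g \<circ> \<phi>) = ip f g" if fg: "f \<in> H" "g \<in> H" for f g
  proof (rule complex_eqI)
    show "Im (ip (f \<circ> \<phi>) (g \<circ> \<phi>)) = Im (ip f g)"
      using Re_ip[OF fg(1) scale_mem[OF fg(2), of \<i>]] fg C(1)[OF fg(1)] C(1)[OF fg(2)]
      by (simp add: o_def ip_scale_right)
  qed (rule Re_ip[OF fg])
  show ?thesis
  proof (rule matrix_eq[THEN iffD2], intro allI cinner_right_ext)
    fix c d
    \<comment> \<open>\<open>g\<close> is the image of \<open>l\<close> under the inverse of the
      composition operator. Unitarity moves the pairing of \<open>k \<circ> \<phi>\<close> with
      \<open>l\<close> to that of \<open>k\<close> with \<open>g\<close>, and evaluating each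
      through a section produces the two kernels.\<close>
    define k l g where "k = kernel_section D K (\<phi> w) c" and "l = kernel_section D K z d"
      and "g = l \<circ> \<phi> ^^ (N - 1)"
    have mem: "k \<in> H" "l \<in> H" by (simp_all add: k_def l_def kernel_mem \<phi> zw)
    then have g: "g \<in> H" "g \<circ> \<phi> = l" using pow undo(2) by (auto simp: g_def)
    have "cinner (K (\<phi> z) (\<phi> w) *v c) d = ip (k \<circ> \<phi>) l"
      using mem zw \<phi> C(1) by (simp add: l_def reproducing) (simp add: k_def kernel_section_def)
    also have "\<dots> = ip k g" using ip_C[OF mem(1) g(1)] g by simp
    also have "\<dots> = cnj (cinner (g (\<phi> w)) c)"
      using ip_commute[OF g(1) mem(1)] g(1) zw \<phi> by (simp add: k_def reproducing)
    also have "g (\<phi> w) = l w" using g(2) by (auto simp: fun_eq_iff)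
    also have "cnj (cinner (l w) c) = cnj (ip l (kernel_section D K w c))"
      using mem zw by (simp add: reproducing)
    also have "\<dots> = ip (kernel_section D K w c) l"
      using ip_commute[OF mem(2) kernel_mem[OF zw(2)]] by simp
    also have "\<dots> = cinner (K z w *v c) d"
      using zw kernel_mem by (simp add: l_def reproducing) (simp add: kernel_section_def)
    finally show "cinner (K (\<phi> z) (\<phi> w) *v c) d = cinner (K z w *v c) d" .
  qed
qed

text \<open>Invariance says that composition sends the section at \<open>\<phi> w\<close> to the
  section at \<open>w\<close>, preserving inner products. Sections are total, and the functions on
  which composition behaves this way form a closed subspace, hence everything.\<close>

lemma contraction_if_kernel_invariant:
  assumes \<phi>: "\<And>x. \<phi> x \<in> D \<longleftrightarrow> x \<in> D" and surj: "surj \<phi>"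
    and inv: "\<And>z w. z \<in> D \<Longrightarrow> w \<in> D \<Longrightarrow> K (\<phi> z) (\<phi> w) = K z w"
  shows "contraction_into_itself H ip (\<lambda>f. f \<circ> \<phi>)"
proof -
  txt \<open>Requiring \<open>\<langle>C f, C g\<rangle> = \<langle>f, g\<rangle>\<close> against every admissible \<open>g\<close>, and not only the equality of
    norms, makes \<open>S\<close> a subspace.\<close>
  define S where "S = {f \<in> H. f \<circ> \<phi> \<in> H \<and> (\<forall>g\<in>H. g \<circ> \<phi> \<in> H \<longrightarrow> ip (f \<circ> \<phi>) (g \<circ> \<phi>) = ip f g)}"
  have S: "f \<in> H" "f \<circ> \<phi> \<in> H" "\<And>g. g \<in> H \<Longrightarrow> g \<circ> \<phi> \<in> H \<Longrightarrow> ip (f \<circ> \<phi>) (g \<circ> \<phi>) = ip f g"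
    if "f \<in> S" for f using that by (auto simp: S_def)
  have iso: "ip_norm ip (f \<circ> \<phi>) = ip_norm ip f" if "f \<in> S" for f
    using S[OF that] by (simp add: ip_norm_def)
  have S_add: "(\<lambda>x. f x + g x) \<in> S" if fg: "f \<in> S" "g \<in> S" for f g
    using S[OF fg(1)] S[OF fg(2)] add_mem[of "f \<circ> \<phi>" "g \<circ> \<phi>"] ip_add[of "f \<circ> \<phi>" "g \<circ> \<phi>"]
    by (simp add: S_def add_mem ip_add o_def)
  have S_scale: "(\<lambda>x. c *s f x) \<in> S" if f: "f \<in> S" for f c
    using S[OF f] scale_mem[of "f \<circ> \<phi>"] ip_scale[of "f \<circ> \<phi>"]
    by (simp add: S_def scale_mem ip_scale o_def)
  have S_diff: "(\<lambda>x. f x - g x) \<in> S" if "f \<in> S" "g \<in> S" for f g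
    using S_add[OF that(1) S_scale[OF that(2), of "-1"]] by simp
  have section_mem: "kernel_section D K (\<phi> w) c \<in> S" if w: "w \<in> D" for w c
  proof -
    have comp: "kernel_section D K (\<phi> w) c \<circ> \<phi> = kernel_section D K w c"
      using w by (auto simp: kernel_section_def \<phi> inv)
    \<comment> \<open>By reproduction both sides are the conjugate of
      \<open>cinner (g (\<phi> w)) c\<close>.\<close>
    have "ip (kernel_section D K w c) (g \<circ> \<phi>) = ip (kernel_section D K (\<phi> w) c) g"
      if "g \<in> H" "g \<circ> \<phi> \<in> H" for g
      using that w ip_commute[OF that(1) kernel_mem[of "\<phi> w"]] ip_commute[OF that(2) kernel_mem[of w]]
      by (simp add: reproducing \<phi>)
    then show ?thesis using w by (simp add: S_def comp kernel_mem \<phi>)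
  qed
  have "S = H"
  proof (rule closed_subspace_total)
    show "S \<subseteq> H" using S(1) by blast
    show "(\<lambda>x. 0) \<in> S"
      using S_scale[of _ 0] section_mem zero_mem ip_scale[of "\<lambda>x. 0" _ 0] by (auto simp: S_def o_def)
    show "(\<lambda>x. f x + g x) \<in> S" if "f \<in> S" "g \<in> S" for f g by (rule S_add[OF that])
    show "(\<lambda>x. c *s f x) \<in> S" if "f \<in> S" for f c by (rule S_scale[OF that])
    show "f = (\<lambda>x. 0)" if f: "f \<in> H" "\<And>s. s \<in> S \<Longrightarrow> ip f s = 0" for f
    proof
      fix w
      show "f w = 0"
      proof (cases "w \<in> D")
        case True
        obtain v where v: "w = \<phi> v" using surj by (metis surjD)
        \<comment> \<open>Membership in \<open>S\<close> was shown for sections at points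
          \<open>\<phi> v\<close>; surjectivity makes these all the sections.\<close>
        have "cinner (f w) c = cinner 0 c" for c
          using f(2)[OF section_mem[of v c]] f(1) True v \<phi> by (simp add: reproducing) (simp add: cinner_def)
        then show ?thesis by (rule cinner_right_ext)
      qed (rule zero_outside[OF f(1)])
    qed
    show "f \<in> S" if F: "\<And>n::nat. F n \<in> S" and f: "f \<in> H"
      and lim: "(\<lambda>n. ip_norm ip (\<lambda>x. F n x - f x)) \<longlonglongrightarrow> 0" for F f
    proof -
      have FH: "F n \<in> H" "F n \<circ> \<phi> \<in> H" for n using S F by auto
      \<comment> \<open>Composition is isometric on \<open>S\<close>, so the composed sequence is
        again Cauchy. Its limit is then identified with \<open>f \<circ> \<phi>\<close>
        pointwise.\<close>
      have "\<exists>h\<in>H. (\<lambda>n. ip_norm ip (\<lambda>x. (F n \<circ> \<phi>) x - h x)) \<longlonglongrightarrow> 0"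
      proof (rule complete[OF FH(2)])
        fix e :: real assume "e > 0"
        then have "\<forall>\<^sub>F n in sequentially. ip_norm ip (\<lambda>x. F n x - f x) < e / 2"
          using order_tendstoD(2)[OF lim, of "e / 2"] by simp
        then obtain M where M: "\<And>n. n \<ge> M \<Longrightarrow> ip_norm ip (\<lambda>x. F n x - f x) < e / 2"
          by (auto simp: eventually_sequentially)
        show "\<exists>M. \<forall>m\<ge>M. \<forall>n\<ge>M. ip_norm ip (\<lambda>x. (F m \<circ> \<phi>) x - (F n \<circ> \<phi>) x) < e"
        proof (intro exI[of _ M] allI impI)
          fix m n assume mn: "M \<le> m" "M \<le> n"
          have "ip_norm ip (\<lambda>x. (F m \<circ> \<phi>) x - (F n \<circ> \<phi>) x) = ip_norm ip (\<lambda>x. F m x - F n x)"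
            using iso[OF S_diff[OF F[of m] F[of n]]] by (simp add: o_def)
          also have "\<dots> < e"
            using ip_norm_diff_triangle[OF FH(1) f FH(1), of m n] M[OF mn(1)] M[OF mn(2)]
              ip_norm_minus_commute[OF f FH(1), of n] by simp
          finally show "ip_norm ip (\<lambda>x. (F m \<circ> \<phi>) x - (F n \<circ> \<phi>) x) < e" .
        qed
      qed
      then obtain h where h: "h \<in> H" and lim_h: "(\<lambda>n. ip_norm ip (\<lambda>x. (F n \<circ> \<phi>) x - h x)) \<longlonglongrightarrow> 0"
        by blast
      have h_eq: "h = f \<circ> \<phi>"
      proof
        fix z
        show "h z = (f \<circ> \<phi>) z"
        proof (cases "z \<in> D")
          case True
          show ?thesis
          proof (rule cinner_right_ext)
            fix d
            have "(\<lambda>n. cinner (F n (\<phi> z)) d) \<longlonglongrightarrow> cinner (h z) d"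
              using tendsto_cinner_eval[OF FH(2) h True lim_h] by simp
            moreover have "(\<lambda>n. cinner (F n (\<phi> z)) d) \<longlonglongrightarrow> cinner (f (\<phi> z)) d"
              using tendsto_cinner_eval[OF FH(1) f _ lim] True \<phi> by simp
            ultimately show "cinner (h z) d = cinner ((f \<circ> \<phi>) z) d"
              using LIMSEQ_unique by fastforce
          qed
        next
          case False
          then show ?thesis using zero_outside[OF h] zero_outside[OF f] \<phi> by simp
        qed
      qed
      have "ip (f \<circ> \<phi>) (g \<circ> \<phi>) = ip f g" if g: "g \<in> H" "g \<circ> \<phi> \<in> H" for g
      proof (rule LIMSEQ_unique)
        show "(\<lambda>n. ip (F n) g) \<longlonglongrightarrow> ip f g" by (rule tendsto_ip_left[OF FH(1) f g(1) lim])
        show "(\<lambda>n. ip (F n) g) \<longlonglongrightarrow> ip (f \<circ> \<phi>) (g \<circ> \<phi>)"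
          using tendsto_ip_left[OF FH(2) h g(2) lim_h] by (simp only: S(3)[OF F g] h_eq)
      qed
      then show ?thesis using f h h_eq by (simp add: S_def)
    qed
  qed
  then show ?thesis using S iso by (auto simp: contraction_into_itself_def)
qed

end

subsection \<open>Contractive matrices\<close>

lemma inner_conj_transpose:
  fixes A :: "complex ^ 'n ^ 'm"
  shows "(A *v x) \<bullet> y = x \<bullet> (conj_transpose A *v y)"
proof -
  have "cinner (A *v x) y = cinner x (conj_transpose A *v y)"
    unfolding cinner_def matrix_vector_mult_def conj_transpose_def
    by (simp add: sum_distrib_left sum_distrib_right ac_simps) (rule sum.swap)
  then show ?thesis by (simp add: inner_eq_Re_cinner)
qed

lemma conj_transpose_conj_transpose [simp]: "conj_transpose (conj_transpose A) = A"
  by (simp add: conj_transpose_def vec_eq_iff)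

lemma conj_transpose_mult: "conj_transpose (A ** B) = conj_transpose B ** conj_transpose A"
  by (simp add: conj_transpose_def matrix_matrix_mult_def vec_eq_iff mult.commute)

text \<open>With u the image of v under the adjoint, the square of the norm of u is the pairing of A
  u with v; apply Cauchy-Schwarz and cancel the norm of u.\<close>

lemma norm_conj_transpose_le:
  fixes A :: "complex ^ 'n ^ 'm"
  assumes "\<And>v. norm (A *v v) \<le> norm v"
  shows "norm (conj_transpose A *v v) \<le> norm v"
proof -
  let ?u = "conj_transpose A *v v"
  have "norm ?u * norm ?u = (A *v ?u) \<bullet> v"
    by (simp add: inner_conj_transpose flip: power2_eq_square power2_norm_eq_inner)
  also have "\<dots> \<le> norm (A *v ?u) * norm v" by (rule norm_cauchy_schwarz)
  also have "\<dots> \<le> norm ?u * norm v" using assms by (intro mult_right_mono) auto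
  finally show ?thesis by (cases "norm ?u = 0") auto
qed

lemma inner_smult_left:
  fixes x y :: "complex ^ 'n"
  shows "(c *s x) \<bullet> y = x \<bullet> (cnj c *s y)"
  by (simp add: inner_eq_Re_cinner cinner_def ac_simps)

lemma scaleR_eq_smult:
  fixes x :: "complex ^ 'n"
  shows "r *\<^sub>R x = of_real r *s x"
  unfolding vec_eq_iff vector_scaleR_component by (simp add: scaleR_conv_of_real)

text \<open>The norm bound forces single-valuedness: two values over one point differ by a value
  over 0, which must vanish. Complex linearity is inherited from the relation.\<close>

lemma contractive_matrix_of_graph:
  fixes P :: "((complex ^ 'n) \<times> (complex ^ 'm)) set"
  assumes add: "\<And>x y x' y'. (x, y) \<in> P \<Longrightarrow> (x', y') \<in> P \<Longrightarrow> (x + x', y + y') \<in> P"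
    and scale: "\<And>c x y. (x, y) \<in> P \<Longrightarrow> (c *s x, c *s y) \<in> P"
    and le: "\<And>x y. (x, y) \<in> P \<Longrightarrow> norm y \<le> norm x"
    and dom: "\<And>x. \<exists>y. (x, y) \<in> P"
  shows "\<exists>T :: complex ^ 'n ^ 'm. \<forall>x y. (x, y) \<in> P \<longleftrightarrow> y = T *v x"
proof -
  obtain t where t: "\<And>x. (x, t x) \<in> P" using dom by metis
  have uniq: "y = y'" if "(x, y) \<in> P" "(x, y') \<in> P" for x y y'
    using le[OF add[OF that(1) scale[OF that(2), of "-1"]]] by simp
  have "Vector_Spaces.linear (*s) (*s) t"
    by unfold_locales (auto intro!: uniq[OF t] add scale t simp: algebra_simps)
  then have "t x = matrix t *v x" for x by (simp add: matrix_works)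
  then show ?thesis using t uniq by metis
qed

text \<open>Equal Gram data make \<open>u i \<mapsto> v i\<close> a well-defined isometry on the
  span. Only real inner products and real spans occur; \<open>scale\<close> makes the span a complex
  subspace, so that the extension is a complex matrix.\<close>

lemma contractive_extension:
  fixes u v :: "'i \<Rightarrow> complex ^ 'n"
  assumes gram: "\<And>i j. u i \<bullet> u j = v i \<bullet> v j"
    and scale: "\<And>c i. \<exists>j. u j = c *s u i \<and> v j = c *s v i"
  shows "\<exists>T :: complex ^ 'n ^ 'n. (\<forall>i. T *v u i = v i) \<and> (\<forall>x. norm (T *v x) \<le> norm x)"
proof -
  define S where "S = span (range (\<lambda>i. (u i, v i)))"
  have gram1: "fst p \<bullet> u j = snd p \<bullet> v j" if "p \<in> S" for p j
    using that unfolding S_def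
    by (induction rule: span_induct_alt) (auto simp: inner_add_left gram)
  have gram2: "fst p \<bullet> fst q = snd p \<bullet> snd q" if "p \<in> S" "q \<in> S" for p q
    using that(2) unfolding S_def
    by (induction rule: span_induct_alt) (auto simp: inner_add_right gram1[OF that(1)])
  have S_scale: "(c *s fst p, c *s snd p) \<in> S" if "p \<in> S" for p c
    using that unfolding S_def
  proof (induction rule: span_induct_alt)
    case base
    then show ?case by (simp add: span_zero flip: zero_prod_def)
  next
    case (step r p q)
    then obtain i j where i: "p = (u i, v i)" and "u j = c *s u i \<and> v j = c *s v i"
      using scale by blast
    then have eq: "(c *s fst (r *\<^sub>R p + q), c *s snd (r *\<^sub>R p + q))
        = r *\<^sub>R (u j, v j) + (c *s fst q, c *s snd q)"
      by (simp add: scaleR_eq_smult algebra_simps)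
    show ?case unfolding eq by (intro span_add span_scale span_base step(2)) auto
  qed
  txt \<open>\<open>P\<close> is the graph of the isometry \<open>S\<close>, extended by \<open>0\<close> on the orthogonal complement of its
    domain. Real orthogonality suffices because \<open>S\<close> is closed under complex scaling.\<close>
  define P where "P = {(fst p + z, snd p) | p z. p \<in> S \<and> (\<forall>q\<in>S. z \<bullet> fst q = 0)}"
  have "\<exists>T :: complex ^ 'n ^ 'n. \<forall>x y. (x, y) \<in> P \<longleftrightarrow> y = T *v x"
  proof (rule contractive_matrix_of_graph)
    fix x y x' y' assume "(x, y) \<in> P" "(x', y') \<in> P"
    then obtain p z p' z' where "p \<in> S" "p' \<in> S" "x = fst p + z" "x' = fst p' + z'" "y = snd p" "y' = snd p'"
      "\<forall>q\<in>S. z \<bullet> fst q = 0" "\<forall>q\<in>S. z' \<bullet> fst q = 0"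
      by (auto simp: P_def)
    moreover from this have "p + p' \<in> S" by (simp add: S_def span_add)
    ultimately have "(x + x', y + y') = (fst (p + p') + (z + z'), snd (p + p'))" "p + p' \<in> S"
      "\<forall>q\<in>S. (z + z') \<bullet> fst q = 0"
      by (simp_all add: inner_add_left)
    then show "(x + x', y + y') \<in> P" unfolding P_def by blast
  next
    fix c x y assume "(x, y) \<in> P"
    then obtain p z where p: "p \<in> S" "x = fst p + z" "y = snd p" "\<forall>q\<in>S. z \<bullet> fst q = 0"
      by (auto simp: P_def)
    have "(c *s z) \<bullet> fst q = 0" if "q \<in> S" for q
      \<comment> \<open>The scalar moves across the inner product as its conjugate onto
        \<open>fst q\<close>, and the rescaled pair is still in \<open>S\<close>.\<close>
      using p(4) S_scale[OF that, of "cnj c"] by (force simp: inner_smult_left)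
    moreover have "(c *s x, c *s y) = (fst (c *s fst p, c *s snd p) + c *s z, snd (c *s fst p, c *s snd p))"
      using p by (simp add: vec.scale_right_distrib)
    ultimately show "(c *s x, c *s y) \<in> P" using S_scale[OF p(1), of c]
      unfolding P_def by blast
  next
    fix x y assume "(x, y) \<in> P"
    then obtain p z where p: "p \<in> S" "x = fst p + z" "y = snd p" "\<forall>q\<in>S. z \<bullet> fst q = 0"
      by (auto simp: P_def)
    have "y \<bullet> y = fst p \<bullet> fst p" using gram2 p by simp
    also have "\<dots> \<le> fst p \<bullet> fst p + z \<bullet> z" by simp
    also have "\<dots> = x \<bullet> x" using p by (simp add: inner_add_left inner_add_right inner_commute)
    finally show "norm y \<le> norm x" by (simp add: norm_le)
  next
    fix x
    have "subspace (fst ` S)"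
      unfolding S_def by (intro linear_subspace_image linear_fst subspace_span)
    then have "span (fst ` S) = fst ` S" by (rule span_eq_iff[THEN iffD2])
    then obtain a z where "a \<in> fst ` S" "\<And>w. w \<in> fst ` S \<Longrightarrow> orthogonal z w" "x = a + z"
      using orthogonal_subspace_decomp_exists[of "fst ` S" x] by metis
    then show "\<exists>y. (x, y) \<in> P" unfolding P_def orthogonal_def by blast
  qed
  then obtain T where T: "\<And>x y. (x, y) \<in> P \<longleftrightarrow> y = T *v x" by blast
  show ?thesis
  proof (intro exI[of _ T] conjI allI)
    fix i
    have "(u i, v i) \<in> S" by (simp add: S_def span_base)
    moreover have "(u i, v i) = (fst (u i, v i) + 0, snd (u i, v i))" by simp
    ultimately have "(u i, v i) \<in> P" unfolding P_def mem_Collect_eq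
      by (intro exI conjI) auto
    then show "T *v u i = v i" using T by simp
  next
    fix x
    have "(x, T *v x) \<in> P" using T by simp
    then obtain p z where p: "p \<in> S" "x = fst p + z" "T *v x = snd p" "\<forall>q\<in>S. z \<bullet> fst q = 0"
      by (auto simp: P_def)
    have "norm (T *v x) = norm (fst p)" using gram2 p by (simp add: norm_eq)
    moreover have "fst p \<bullet> fst p \<le> x \<bullet> x"
      using p by (simp add: inner_add_left inner_add_right inner_commute)
    ultimately show "norm (T *v x) \<le> norm x" by (simp add: norm_le)
  qed
qed

subsection \<open>Polarization of Gram identities\<close>

text \<open>Conjugating the second variable makes the sum a function \<open>F\<close> holomorphic in
  each variable that vanishes on w = cnj z. Finite sums of this kind are the entries of matrix
  products such as W(z) times the adjoint of W(w).\<close>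

lemma holomorphic_zero_off_diagonal:
  fixes f g :: "'k::finite \<Rightarrow> complex \<Rightarrow> complex"
  assumes f: "\<And>k. f k holomorphic_on ball 0 1" and g: "\<And>k. g k holomorphic_on ball 0 1"
    and diag: "\<And>z. z \<in> ball 0 1 \<Longrightarrow> (\<Sum>k\<in>UNIV. f k z * cnj (g k z)) = 0"
    and zw: "z \<in> ball 0 1" "w \<in> ball 0 1"
  shows "(\<Sum>k\<in>UNIV. f k z * cnj (g k w)) = 0"
proof -
  define h where "h k = cnj \<circ> g k \<circ> cnj" for k
  have h: "h k holomorphic_on ball 0 1" for k
    unfolding h_def by (intro holomorphic_on_compose_cnj_cnj holomorphic_on_subset[OF g]) auto
  define F where "F z w = (\<Sum>k\<in>UNIV. f k z * h k w)" for z w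
  have F_hol: "(\<lambda>x. F (a x) (b x)) holomorphic_on A"
    if "a holomorphic_on A" "b holomorphic_on A" "a ` A \<subseteq> ball 0 1" "b ` A \<subseteq> ball 0 1" for a b A
  proof -
    have "(\<lambda>x. f k (a x)) holomorphic_on A" "(\<lambda>x. h k (b x)) holomorphic_on A" for k
      using holomorphic_on_compose_gen[OF that(1) f that(3)] holomorphic_on_compose_gen[OF that(2) h that(4)]
      by (simp_all add: o_def)
    then show ?thesis unfolding F_def by (intro holomorphic_intros)
  qed
  have F_diag: "F z (cnj z) = 0" if "z \<in> ball 0 1" for z
    using diag[OF that] by (simp add: F_def h_def)
  \<comment> \<open>Radius 1/2 for x and y keeps x + i y and x - i y inside the unit disk.\<close>
  have small: "x + \<i> * y \<in> ball 0 1" "x - \<i> * y \<in> ball 0 1"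
    if "x \<in> ball 0 (1/2)" "y \<in> ball 0 (1/2)" for x y
    using that norm_triangle_ineq[of x "\<i> * y"] norm_triangle_ineq4[of x "\<i> * y"]
    by (simp_all add: norm_mult)
  have islimpt: "0 islimpt (of_real ` {-1/2<..<1/2} :: complex set)"
    unfolding islimpt_approachable
  proof (intro allI impI)
    fix e :: real assume "e > 0"
    then show "\<exists>x\<in>of_real ` {-1/2<..<1/2}. x \<noteq> 0 \<and> dist x (0::complex) < e"
      by (intro bexI[of _ "of_real (min (e / 2) (1 / 4))"] imageI) (auto simp: min_def)
  qed
  txt \<open>In the coordinates \<open>z = x + i y\<close>, \<open>w = x - i y\<close> the diagonal \<open>w = cnj z\<close> is the set where \<open>x\<close> and
    \<open>y\<close> are both real, so the identity theorem applies in one variable at a time.\<close>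
  have real_cont: "\<phi> x = 0" if "\<phi> holomorphic_on ball 0 (1/2)"
    "\<And>t::real. \<bar>t\<bar> < 1/2 \<Longrightarrow> \<phi> (of_real t) = 0" "x \<in> ball 0 (1/2)" for \<phi> and x :: complex
    by (rule analytic_continuation[OF that(1) _ _ _ _ islimpt _ that(3)])
       (use that(2) in \<open>auto simp: abs_if field_simps\<close>)
  have 1: "F (of_real s + \<i> * y) (of_real s - \<i> * y) = 0"
    if "\<bar>s\<bar> < 1/2" "y \<in> ball 0 (1/2)" for s :: real and y
  proof (rule real_cont[OF _ _ that(2)])
    show "(\<lambda>y. F (of_real s + \<i> * y) (of_real s - \<i> * y)) holomorphic_on ball 0 (1/2)"
      using small that by (intro F_hol holomorphic_intros) auto
    fix t :: real assume "\<bar>t\<bar> < 1/2"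
    then show "F (of_real s + \<i> * of_real t) (of_real s - \<i> * of_real t) = 0"
      using F_diag[of "of_real s + \<i> * of_real t"] small(1)[of "of_real s" "of_real t"] that by simp
  qed
  have 2: "F (x + \<i> * y) (x - \<i> * y) = 0" if "x \<in> ball 0 (1/2)" "y \<in> ball 0 (1/2)" for x y
  proof (rule real_cont[OF _ _ that(1)])
    show "(\<lambda>x. F (x + \<i> * y) (x - \<i> * y)) holomorphic_on ball 0 (1/2)"
      using small that by (intro F_hol holomorphic_intros) auto
  qed (use 1 that in auto)
  \<comment> \<open>Inverts the change of coordinates: x = (z + w) / 2 and y = (z - w) / (2
    i).\<close>
  have 3: "F z w = 0" if "z \<in> ball 0 (1/2)" "w \<in> ball 0 (1/2)" for z w
  proof -
    have "(z + w) / 2 \<in> ball 0 (1/2)" "(z - w) / (2 * \<i>) \<in> ball 0 (1/2)"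
      using that norm_triangle_ineq[of z w] norm_triangle_ineq4[of z w]
      by (simp_all add: norm_divide norm_mult)
    from 2[OF this] show ?thesis by (simp add: field_simps)
  qed
  \<comment> \<open>Vanishing on the half disk spreads to the unit disk, first in z and then in
    w.\<close>
  have disk_cont: "\<phi> x = 0" if "\<phi> holomorphic_on ball 0 1"
    "\<And>t. t \<in> ball 0 (1/2) \<Longrightarrow> \<phi> t = 0" "x \<in> ball 0 1" for \<phi> and x :: complex
    by (rule analytic_continuation[OF that(1), of "ball 0 (1/2)" 0])
       (use that in \<open>auto simp: islimpt_ball\<close>)
  have 4: "F z w = 0" if "z \<in> ball 0 1" "w \<in> ball 0 (1/2)" for z w
    by (rule disk_cont[OF _ _ that(1)], rule F_hol) (use 3 that in auto)
  have "F z (cnj w) = 0"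
    by (rule disk_cont[of "F z"], rule F_hol) (use 4 zw in auto)
  then show ?thesis by (simp add: F_def h_def)
qed

subsection \<open>Factorizations of Schur functions\<close>

text \<open>The hypothesis gives equal inner products for the vectors in the ranges of the adjoints
  of \<open>B i\<close> and \<open>A i\<close>. A contraction \<open>T\<close> carrying the former
  to the latter exists, and its adjoint is the factor.\<close>

lemma common_right_factor:
  fixes A B :: "'i \<Rightarrow> complex ^ 'q ^ 'p"
  assumes gram: "\<And>i j. A i ** conj_transpose (A j) = B i ** conj_transpose (B j)"
  shows "\<exists>X :: complex ^ 'q ^ 'q. (\<forall>v. norm (X *v v) \<le> norm v) \<and> (\<forall>i. A i = B i ** X)"
proof -
  \<comment> \<open>Indexing by pairs (i, c) makes both families closed under complex scaling: it
    suffices to scale c.\<close>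
  define u v where "u = (\<lambda>(i, c). conj_transpose (B i) *v c)" and "v = (\<lambda>(i, c). conj_transpose (A i) *v c)"
  have "u i \<bullet> u j = v i \<bullet> v j" for i j
    by (cases i; cases j) (simp add: u_def v_def inner_conj_transpose matrix_vector_mul_assoc gram)
  moreover have "\<exists>j. u j = c *s u i \<and> v j = c *s v i" for c i
    by (intro exI[of _ "(fst i, c *s snd i)"]) (simp add: u_def v_def vector_scalar_commute split_beta)
  ultimately obtain T where T: "\<And>i. T *v u i = v i" and le: "\<And>x. norm (T *v x) \<le> norm x"
    using contractive_extension by metis
  have "conj_transpose (A i) = T ** conj_transpose (B i)" for i
    using T[of "(i, _)"] by (simp add: matrix_eq u_def v_def matrix_vector_mul_assoc)
  then have "A i = B i ** conj_transpose T" for i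
    by (metis conj_transpose_conj_transpose conj_transpose_mult)
  then show ?thesis using norm_conj_transpose_le[OF le] by blast
qed

text \<open>Real polarization suffices, since real inner products against all vectors determine a
  vector.\<close>

lemma gram_eq_if_norm_eq:
  fixes A B :: "complex ^ 'q ^ 'p"
  assumes "\<And>c. norm (conj_transpose A *v c) = norm (conj_transpose B *v c)"
  shows "A ** conj_transpose A = B ** conj_transpose B"
proof -
  have "(conj_transpose A *v d) \<bullet> (conj_transpose A *v c) = (conj_transpose B *v d) \<bullet> (conj_transpose B *v c)" for c d
    by (simp only: dot_norm assms flip: matrix_vector_right_distrib)
  then have "d \<bullet> (A ** conj_transpose A *v c) = d \<bullet> (B ** conj_transpose B *v c)" for c d
    by (simp add: inner_conj_transpose matrix_vector_mul_assoc)
  then have "A ** conj_transpose A *v c = B ** conj_transpose B *v c" for c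
    using vector_eq_ldot by blast
  then show ?thesis by (simp add: matrix_eq)
qed

lemma gram_eq_if_factor:
  fixes W :: "complex \<Rightarrow> complex ^ 'q ^ 'p"
  assumes W: "schur_function W" and X: "schur_function X"
    and \<epsilon>: "cmod \<epsilon> = 1" "\<epsilon> ^ N = 1" "N > 0"
    and fac: "\<And>z. z \<in> unit_disk \<Longrightarrow> W z = W (\<epsilon> * z) ** X z"
    and zw: "z \<in> unit_disk" "w \<in> unit_disk"
  shows "W z ** conj_transpose (W w) = W (\<epsilon> * z) ** conj_transpose (W (\<epsilon> * w))"
proof -
  have hol: "(\<lambda>z. W z $ i $ j) holomorphic_on unit_disk" for i j
    using W by (simp add: schur_function_def)
  have disk: "\<epsilon> * z \<in> unit_disk" if "z \<in> unit_disk" for z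
    using that \<epsilon> by (simp add: norm_mult)
  have hol': "(\<lambda>z. W (\<epsilon> * z) $ i $ j) holomorphic_on unit_disk" for i j
  proof -
    have "(\<lambda>z. \<epsilon> * z) holomorphic_on unit_disk" by (intro holomorphic_intros)
    moreover have "(\<lambda>z. \<epsilon> * z) ` unit_disk \<subseteq> unit_disk" using disk by blast
    ultimately show ?thesis using holomorphic_on_compose_gen[OF _ hol] by (simp add: o_def)
  qed
  have step: "norm (conj_transpose (W z) *v c) \<le> norm (conj_transpose (W (\<epsilon> * z)) *v c)"
    if z: "z \<in> unit_disk" for z c
  proof -
    have "conj_transpose (W z) *v c = conj_transpose (X z) *v (conj_transpose (W (\<epsilon> * z)) *v c)"
      by (subst fac[OF z]) (simp add: conj_transpose_mult matrix_vector_mul_assoc)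
    then show ?thesis using X z norm_conj_transpose_le[of "X z"] by (simp add: schur_function_def)
  qed
  have iter: "norm (conj_transpose (W z) *v c) \<le> norm (conj_transpose (W (\<epsilon> ^ n * z)) *v c)"
    if z: "z \<in> unit_disk" for z c n
    using z
  proof (induction n arbitrary: z)
    case (Suc n)
    have "\<epsilon> ^ Suc n * z = \<epsilon> ^ n * (\<epsilon> * z)" by (simp only: power_Suc2 mult.assoc)
    then show ?case using order_trans[OF step[OF Suc.prems] Suc.IH[OF disk[OF Suc.prems]]]
      by (simp only:)
  qed simp
  have "norm (conj_transpose (W z) *v c) = norm (conj_transpose (W (\<epsilon> * z)) *v c)"
    if z: "z \<in> unit_disk" for z c
  \<comment> \<open>The norms grow along the orbit of z; after N - 1 further steps from the rotated
    point the orbit is back at z, so they are constant.\<close>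
  proof (rule antisym[OF step[OF z]])
    have "\<epsilon> ^ (N - 1) * (\<epsilon> * z) = z"
      using power_minus_mult[OF \<epsilon>(3), of \<epsilon>] \<epsilon>(2) by (simp flip: mult.assoc)
    then show "norm (conj_transpose (W (\<epsilon> * z)) *v c) \<le> norm (conj_transpose (W z) *v c)"
      using iter[OF disk[OF z], of c "N - 1"] by (simp only:)
  qed
  then have diag: "W z ** conj_transpose (W z) = W (\<epsilon> * z) ** conj_transpose (W (\<epsilon> * z))"
    if "z \<in> unit_disk" for z
    using that by (intro gram_eq_if_norm_eq)
  show ?thesis unfolding vec_eq_iff
  proof (intro allI)
    fix i j
    \<comment> \<open>Indexing by the sum type packs the difference of the two matrix entries into
      one sum; the minus sign sits in \<open>f\<close>.\<close>
    define f where "f = case_sum (\<lambda>k z. W z $ i $ k) (\<lambda>k z. - W (\<epsilon> * z) $ i $ k)"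
    define g where "g = case_sum (\<lambda>k z. W z $ j $ k) (\<lambda>k z. W (\<epsilon> * z) $ j $ k)"
    have sum: "(\<Sum>k\<in>UNIV. f k z * cnj (g k w)) = (W z ** conj_transpose (W w)) $ i $ j
      - (W (\<epsilon> * z) ** conj_transpose (W (\<epsilon> * w))) $ i $ j" for z w
      by (simp add: f_def g_def sum.Plus sum_negf matrix_matrix_mult_def conj_transpose_def
          flip: UNIV_Plus_UNIV)
    have "(\<Sum>k\<in>UNIV. f k z * cnj (g k w)) = 0"
    proof (rule holomorphic_zero_off_diagonal)
      show "f k holomorphic_on unit_disk" for k
        unfolding f_def using hol hol' by (cases k) (auto intro: holomorphic_intros)
      show "g k holomorphic_on unit_disk" for k
        unfolding g_def using hol hol' by (cases k) auto
    qed (use zw sum diag in auto)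
    then show "(W z ** conj_transpose (W w)) $ i $ j
      = (W (\<epsilon> * z) ** conj_transpose (W (\<epsilon> * w))) $ i $ j"
      by (simp add: sum)
  qed
qed

section \<open>The rotation of the disk and the equivalence\<close>

lemma root_of_unity_power: "N > 0 \<Longrightarrow> root_of_unity N ^ N = 1"
  by (simp add: root_of_unity_def flip: exp_of_nat_mult)

lemma norm_root_of_unity: "cmod (root_of_unity N) = 1"
  by (simp add: root_of_unity_def norm_exp_eq_Re)

lemma funpow_rotation: "(rotation N ^^ n) z = root_of_unity N ^ n * z"
  by (induction n) (simp_all add: rotation_def)

text \<open>The denominator of the kernel is unchanged by the rotation and nonzero on the disk, so
  only the numerators matter.\<close>

lemma schur_kernel_rotation_eq_iff:
  assumes "z \<in> unit_disk" "w \<in> unit_disk"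
  shows "schur_kernel W (rotation N z) (rotation N w) = schur_kernel W z w \<longleftrightarrow>
    W z ** conj_transpose (W w)
      = W (root_of_unity N * z) ** conj_transpose (W (root_of_unity N * w))"
proof -
  have "cmod (z * cnj w) < 1"
    using assms mult_strict_mono[of "cmod z" 1 "cmod w" 1] by (simp add: norm_mult)
  then have "1 - z * cnj w \<noteq> 0" by auto
  moreover have "rotation N z * cnj (rotation N w) = z * cnj w"
    using complex_norm_square[of "root_of_unity N"]
    by (simp add: rotation_def norm_root_of_unity)
  ultimately show ?thesis
    unfolding rotation_def[symmetric] schur_kernel_def by (auto simp: vec_eq_iff)
qed

theorem theorem6p4:
  fixes N :: nat
    and W :: "complex \<Rightarrow> complex ^ 'q ^ 'p"
    and H :: "(complex \<Rightarrow> complex ^ 'p) set"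
    and ip :: "(complex \<Rightarrow> complex ^ 'p) \<Rightarrow> (complex \<Rightarrow> complex ^ 'p) \<Rightarrow> complex"
  assumes "N > 0"
    and "schur_function W"
    and "is_schur_space W H ip"
  shows "contraction_into_itself H ip (\<lambda>f. f \<circ> rotation N) \<longleftrightarrow>
         (\<exists>X :: complex \<Rightarrow> complex ^ 'q ^ 'q.
            schur_function X \<and>
            (\<forall>z\<in>unit_disk. W z = W (root_of_unity N * z) ** X z))"
proof -
  interpret reproducing_kernel_hilbert_space unit_disk "schur_kernel W" H ip
    by (fact assms(3))
  let ?\<epsilon> = "root_of_unity N"
  have disk: "rotation N z \<in> unit_disk \<longleftrightarrow> z \<in> unit_disk" for z
    by (simp add: rotation_def norm_mult norm_root_of_unity)
  have per: "(rotation N ^^ N) z = z" for z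
    using \<open>N > 0\<close> by (simp add: funpow_rotation root_of_unity_power)
  have surj: "surj (rotation N)"
    by (rule surjI[of _ "\<lambda>z. z / ?\<epsilon>"]) (use norm_root_of_unity[of N] in \<open>auto simp: rotation_def\<close>)
  show ?thesis
  proof
    assume "contraction_into_itself H ip (\<lambda>f. f \<circ> rotation N)"
    then have gram: "W z ** conj_transpose (W w) = W (?\<epsilon> * z) ** conj_transpose (W (?\<epsilon> * w))"
      if "z \<in> unit_disk" "w \<in> unit_disk" for z w
      using kernel_invariant_if_contraction[OF disk \<open>N > 0\<close> per _ that] that
      by (simp add: schur_kernel_rotation_eq_iff)
    \<comment> \<open>Extension by 0 outside the disk makes the Gram identity hold for all indices,
      as \<open>common_right_factor\<close> requires.\<close>
    define A B where "A z = (if z \<in> unit_disk then W z else 0)"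
      and "B z = (if z \<in> unit_disk then W (?\<epsilon> * z) else 0)" for z
    have zero: "conj_transpose 0 = 0" by (simp add: conj_transpose_def vec_eq_iff)
    have "A z ** conj_transpose (A w) = B z ** conj_transpose (B w)" for z w
      using gram[of z w] by (simp add: A_def B_def zero)
    then obtain X where X: "\<And>v. norm (X *v v) \<le> norm v" "\<And>z. A z = B z ** X"
      using common_right_factor by metis
    have "W z = W (?\<epsilon> * z) ** X" if "z \<in> unit_disk" for z
      using X(2)[of z] that by (simp add: A_def B_def)
    with X(1) show "\<exists>X. schur_function X \<and> (\<forall>z\<in>unit_disk. W z = W (?\<epsilon> * z) ** X z)"
      by (intro exI[of _ "\<lambda>_. X"]) (simp add: schur_function_def)
  next
    assume "\<exists>X. schur_function X \<and> (\<forall>z\<in>unit_disk. W z = W (?\<epsilon> * z) ** X z)"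
    then obtain X where "schur_function X" "\<And>z. z \<in> unit_disk \<Longrightarrow> W z = W (?\<epsilon> * z) ** X z"
      by blast
    then have "schur_kernel W (rotation N z) (rotation N w) = schur_kernel W z w"
      if "z \<in> unit_disk" "w \<in> unit_disk" for z w
      using that gram_eq_if_factor[OF assms(2) _ norm_root_of_unity root_of_unity_power[OF assms(1)] assms(1)]
      by (simp add: schur_kernel_rotation_eq_iff)
    then show "contraction_into_itself H ip (\<lambda>f. f \<circ> rotation N)"
      by (rule contraction_if_kernel_invariant[OF disk surj])
  qed
qed

end
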